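(* Let $(x^*,y^* )\in W$ be such that $F(x^*,y^* )\le F(x,y)$ for all $(x,y)\in T$. Then: (i) $(x^*,y^* )$ is a global solution of the standard optimistic bilevel problem (SBP); (ii) for all $w^*\in U\cap K(x^* )$ such that $(x^*,w^* )\in H(y^* )$, the triple $(x^*,y^*,w^* )$ is a solution (equilibrium) of the generalized Nash equilibrium problem (GNEP).
   Context: Data and standing assumptions: $F,f:\mathbb{R}^{n_1}\times\mathbb{R}^{n_2}\to\mathbb{R}$ and $g:\mathbb{R}^{n_1}\times\mathbb{R}^{n_2}\to\mathbb{R}^m$ are continuous; $X\subseteq\mathbb{R}^{n_1}$ and $U\subseteq\mathbb{R}^{n_2}$ are closed. Vector inequalities are componentwise. Let $K(x):=\{v\in\mathbb{R}^{n_2}: g(x,v)\le 0\}$ and let $S(x)$ be the set of global minimizers of $w\mapsto f(x,w)$ over $w\in U\cap K(x)$ (empty if there are none). Let $T:=\{(x,y)\in X\times U: g(x,y)\le 0\}$ and, for $w\in\mathbb{R}^{n_2}$, $H(w):=\{(x,y)\in\mathbb{R}^{n_1}\times\mathbb{R}^{n_2}: f(x,y)\le f(x,w)\}$. SBP: minimize $F(x,y)$ over $(x,y)\in W$, where $W:=\{(x,y): x\in X,\ y\in S(x)\}$. A global solution of the SBP is a point $(x^*,y^* )\in W$ with $F(x^*,y^* )\le F(x,y)$ for all $(x,y)\in W$. GNEP: a two-player game in which the leader controls $(x,y)$ and minimizes $F(x,y)$ subject to $(x,y)\in X\times U$, $f(x,y)\le f(x,w)$, $g(x,y)\le 0$,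 while the follower controls $w$ and minimizes $f(x,w)$ subject to $w\in U$, $g(x,w)\le 0$. Put $V(w):=T\cap H(w)$. An equilibrium (solution) of the GNEP is a triple $(x^*,y^*,w^* )$ such that $(x^*,y^* )\in V(w^* )$; $F(x^*,y^* )\le F(x,y)$ for all $(x,y)\in V(w^* )$; $w^*\in U\cap K(x^* )$; and $f(x^*,w^* )\le f(x^*,w)$ for all $w\in U\cap K(x^* )$. *)

theory Defs
  imports "HOL-Analysis.Analysis"
begin

text \<open>The order on the constraint space \<open>real ^ 'm\<close> is the library's componentwise order, so
  \<open>g (x, v) \<le> 0\<close> says that every component of \<open>g (x, v)\<close> is nonpositive.\<close>

definition K_set ::
  "((real ^ 'n1) \<times> (real ^ 'n2) \<Rightarrow> real ^ 'm) \<Rightarrow> real ^ 'n1 \<Rightarrow> (real ^ 'n2) set"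
  where "K_set g x = {v. g (x, v) \<le> 0}"

definition S_set ::
  "((real ^ 'n1) \<times> (real ^ 'n2) \<Rightarrow> real) \<Rightarrow> ((real ^ 'n1) \<times> (real ^ 'n2) \<Rightarrow> real ^ 'm)
    \<Rightarrow> (real ^ 'n2) set \<Rightarrow> real ^ 'n1 \<Rightarrow> (real ^ 'n2) set"
  where "S_set f g U x =
    {y \<in> U \<inter> K_set g x. \<forall>w \<in> U \<inter> K_set g x. f (x, y) \<le> f (x, w)}"

definition T_set ::
  "((real ^ 'n1) \<times> (real ^ 'n2) \<Rightarrow> real ^ 'm) \<Rightarrow> (real ^ 'n1) set \<Rightarrow> (real ^ 'n2) set
    \<Rightarrow> ((real ^ 'n1) \<times> (real ^ 'n2)) set"
  where "T_set g X U = {(x, y). (x, y) \<in> X \<times> U \<and> g (x, y) \<le> 0}"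

definition H_set ::
  "((real ^ 'n1) \<times> (real ^ 'n2) \<Rightarrow> real) \<Rightarrow> real ^ 'n2 \<Rightarrow> ((real ^ 'n1) \<times> (real ^ 'n2)) set"
  where "H_set f w = {(x, y). f (x, y) \<le> f (x, w)}"

definition W_set ::
  "((real ^ 'n1) \<times> (real ^ 'n2) \<Rightarrow> real) \<Rightarrow> ((real ^ 'n1) \<times> (real ^ 'n2) \<Rightarrow> real ^ 'm)
    \<Rightarrow> (real ^ 'n1) set \<Rightarrow> (real ^ 'n2) set \<Rightarrow> ((real ^ 'n1) \<times> (real ^ 'n2)) set"
  where "W_set f g X U = {(x, y). x \<in> X \<and> y \<in> S_set f g U x}"

definition SBP_global_solution ::
  "((real ^ 'n1) \<times> (real ^ 'n2) \<Rightarrow> real) \<Rightarrow> ((real ^ 'n1) \<times> (real ^ 'n2) \<Rightarrow> real)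
    \<Rightarrow> ((real ^ 'n1) \<times> (real ^ 'n2) \<Rightarrow> real ^ 'm) \<Rightarrow> (real ^ 'n1) set \<Rightarrow> (real ^ 'n2) set
    \<Rightarrow> (real ^ 'n1) \<times> (real ^ 'n2) \<Rightarrow> bool"
  where "SBP_global_solution F f g X U p \<longleftrightarrow>
    p \<in> W_set f g X U \<and> (\<forall>q \<in> W_set f g X U. F p \<le> F q)"

definition V_set ::
  "((real ^ 'n1) \<times> (real ^ 'n2) \<Rightarrow> real) \<Rightarrow> ((real ^ 'n1) \<times> (real ^ 'n2) \<Rightarrow> real ^ 'm)
    \<Rightarrow> (real ^ 'n1) set \<Rightarrow> (real ^ 'n2) set \<Rightarrow> real ^ 'n2 \<Rightarrow> ((real ^ 'n1) \<times> (real ^ 'n2)) set"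
  where "V_set f g X U w = T_set g X U \<inter> H_set f w"

definition GNEP_equilibrium ::
  "((real ^ 'n1) \<times> (real ^ 'n2) \<Rightarrow> real) \<Rightarrow> ((real ^ 'n1) \<times> (real ^ 'n2) \<Rightarrow> real)
    \<Rightarrow> ((real ^ 'n1) \<times> (real ^ 'n2) \<Rightarrow> real ^ 'm) \<Rightarrow> (real ^ 'n1) set \<Rightarrow> (real ^ 'n2) set
    \<Rightarrow> (real ^ 'n1) \<times> (real ^ 'n2) \<times> (real ^ 'n2) \<Rightarrow> bool"
  where "GNEP_equilibrium F f g X U = (\<lambda>(x, y, w).
    (x, y) \<in> V_set f g X U w \<and>
    (\<forall>(x', y') \<in> V_set f g X U w. F (x, y) \<le> F (x', y')) \<and>
    w \<in> U \<inter> K_set g x \<and>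
    (\<forall>w' \<in> U \<inter> K_set g x. f (x, w) \<le> f (x, w')))"

end

theory Submission
  imports Defs
begin

text \<open>Both feasible sets, \<open>W_set f g X U\<close> and \<open>V_set f g X U ws\<close>,
  lie inside \<open>T_set g X U\<close>, so a point that is optimal over the relaxation
  \<open>T_set g X U\<close> is optimal over each of them once it belongs to it. The follower's part
  rests on \<open>ys\<close> being a lower-level minimizer at \<open>xs\<close>: the condition on
  \<open>ws\<close> forces it to attain the same value.\<close>

theorem proposition3p4:
  fixes F f :: "(real ^ 'n1) \<times> (real ^ 'n2) \<Rightarrow> real"
    and g :: "(real ^ 'n1) \<times> (real ^ 'n2) \<Rightarrow> real ^ 'm"
    and X :: "(real ^ 'n1) set" and U :: "(real ^ 'n2) set"
    and xs :: "real ^ 'n1" and ys :: "real ^ 'n2"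
  assumes "continuous_on UNIV F" and "continuous_on UNIV f" and "continuous_on UNIV g"
    and "closed X" and "closed U"
    and "(xs, ys) \<in> W_set f g X U"
    and "\<forall>(x, y) \<in> T_set g X U. F (xs, ys) \<le> F (x, y)"
  shows "SBP_global_solution F f g X U (xs, ys) \<and>
    (\<forall>ws \<in> U \<inter> K_set g xs. (xs, ws) \<in> H_set f ys \<longrightarrow>
      GNEP_equilibrium F f g X U (xs, ys, ws))"
proof (intro conjI ballI impI)
  have W_T: "W_set f g X U \<subseteq> T_set g X U"
    by (auto simp: W_set_def S_set_def K_set_def T_set_def)
  have opt: "F (xs, ys) \<le> F q" if "q \<in> T_set g X U" for q
    using assms(7) that by (cases q) auto
  show "SBP_global_solution F f g X U (xs, ys)"
    unfolding SBP_global_solution_def using assms(6) W_T opt by blast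
  fix ws
  assume ws: "ws \<in> U \<inter> K_set g xs" and "(xs, ws) \<in> H_set f ys"
  then have le: "f (xs, ws) \<le> f (xs, ys)"
    by (simp add: H_set_def)
  have ys_min: "f (xs, ys) \<le> f (xs, w)" if "w \<in> U \<inter> K_set g xs" for w
    using assms(6) that by (auto simp: W_set_def S_set_def)
  \<comment> \<open>The \<open>H_set f ws\<close> part is the lower-level optimality of
    \<open>ys\<close> tested against the feasible competitor \<open>ws\<close>.\<close>
  have "(xs, ys) \<in> V_set f g X U ws"
    using assms(6) W_T ys_min[OF ws] by (auto simp: V_set_def H_set_def)
  moreover have "F (xs, ys) \<le> F q" if "q \<in> V_set f g X U ws" for q
    using that by (simp add: V_set_def opt)
  \<comment> \<open>By \<open>le\<close>, \<open>ws\<close> does no worse than the minimizer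
    \<open>ys\<close>, so it is itself a best response.\<close>
  moreover have "f (xs, ws) \<le> f (xs, w)" if "w \<in> U \<inter> K_set g xs" for w
    using le ys_min[OF that] by linarith
  ultimately show "GNEP_equilibrium F f g X U (xs, ys, ws)"
    using ws by (auto simp: GNEP_equilibrium_def)
qed

end
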